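(* Let $q\ge2$ be a prime power, let $2\le k<n$, and let $D$ be a $(k-1)$-$(n,k,1)_q$-design. Let $C$ be the set of all $(k+1)$-dimensional subspaces $U$ of $\mathbb{F}_q^n$ such that no element of $D$ is contained in $U$. If $C$ and its complement in the vertex set of $J_q(n,k+1)$ are both nonempty, then $C$ is a completely regular code in the Grassmann graph $J_q(n,k+1)$ with covering radius $1$.
   Context: The Grassmann graph $J_q(n,k)$ has as vertices the $k$-dimensional subspaces of $\mathbb{F}_q^n$, adjacent iff they meet in a $(k-1)$-dimensional subspace. A $t$-$(n,k,\lambda)_q$-design is a set $D$ of $k$-dimensional subspaces of $\mathbb{F}_q^n$ (without repetition) such that every $t$-dimensional subspace of $\mathbb{F}_q^n$ is contained in exactly $\lambda$ elements of $D$. A nonempty vertex set $C$ of a regular graph is a completely regular code with covering radius $1$ if every vertex is in $C$ or adjacent to $C$, not all vertices are in $C$, and there are numbers $\beta_0,\gamma_1$ such that every vertex of $C$ has exactly $\beta_0$ neighbours outside $C$ and every vertex outside $C$ has exactly $\gamma_1$ neighbours in $C$. *)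

theory Defs
  imports "HOL-Analysis.Analysis"
begin

text \<open>The space F_q^n is modelled as 'a ^ 'n with 'a a finite field (|'a| = q, any prime power)
  and CARD('n) = n. Subspaces and dimension are those of the library vector space vec.\<close>

definition subspaces_of_dim :: "nat \<Rightarrow> ('a::field ^ 'n) set set" where
  "subspaces_of_dim k = {U. vec.subspace U \<and> vec.dim U = k}"

text \<open>Grassmann graph J_q(n,k): vertices are the k-subspaces, adjacent iff they meet in a
  (k-1)-dimensional subspace.\<close>
definition grassmann_adj :: "nat \<Rightarrow> ('a::field ^ 'n) set \<Rightarrow> ('a ^ 'n) set \<Rightarrow> bool" where
  "grassmann_adj k U W \<longleftrightarrow> U \<in> subspaces_of_dim k \<and> W \<in> subspaces_of_dim k
      \<and> vec.dim (U \<inter> W) = k - 1"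

text \<open>A t-(n,k,lambda)_q design: a set of k-subspaces such that every t-subspace lies in exactly
  lambda of them.\<close>
definition is_q_design :: "nat \<Rightarrow> nat \<Rightarrow> nat \<Rightarrow> ('a::field ^ 'n) set set \<Rightarrow> bool" where
  "is_q_design t k lam D \<longleftrightarrow> D \<subseteq> subspaces_of_dim k \<and>
     (\<forall>T \<in> subspaces_of_dim t. card {B \<in> D. T \<subseteq> B} = lam)"

text \<open>Completely regular code with covering radius 1 in the graph (V, adj).\<close>
definition crc_radius1 :: "'v set \<Rightarrow> ('v \<Rightarrow> 'v \<Rightarrow> bool) \<Rightarrow> 'v set \<Rightarrow> bool" where
  "crc_radius1 V adj C \<longleftrightarrow> C \<noteq> {} \<and> C \<subseteq> V \<and> C \<noteq> V \<and>
     (\<forall>v \<in> V. v \<in> C \<or> (\<exists>c \<in> C. adj v c)) \<and>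
     (\<exists>beta0 gamma1.
        (\<forall>c \<in> C. card {v \<in> V - C. adj c v} = beta0) \<and>
        (\<forall>v \<in> V - C. card {c \<in> C. adj v c} = gamma1))"

end

(*
  A (k+1)-subspace contains at most one block, because two blocks in it meet in a (k-1)-subspace,
  which lies in a unique block. If U is a (k+1)-subspace and W a neighbour of U containing a block B
  not contained in U, then W = B + (U \<inter> W) and (B \<inter> U, U \<inter> W) is a flag of a (k-1)- and
  a k-subspace of U whose block is not in U; conversely every such flag (T, H) gives the neighbour
  block(T) + H. Hence a block-free U has as many neighbours outside the code as it has such flags,
  and a subspace v containing the block B0 has as neighbours outside the code the (k+1)-subspaces
  other than v through B0 together with those coming from flags (T, H) of v with T not in B0.
  These counts only depend on the pair B0 \<subseteq> v up to linear automorphisms, which act transitively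
  on such pairs, so they are constant. Every (k+1)-subspace has such flags, so beta_0 > 0, hence
  gamma_1 > 0 and C covers every vertex.
*)

theory Submission
  imports Defs
begin

section \<open>Linear algebra in 'a ^ 'n\<close>

abbreviation subspace_sum :: "('a::field ^ 'n) set \<Rightarrow> ('a ^ 'n) set \<Rightarrow> ('a ^ 'n) set" where
  "subspace_sum X Y \<equiv> {x + y |x y. x \<in> X \<and> y \<in> Y}"

lemma subspaces_of_dimD:
  "X \<in> subspaces_of_dim d \<Longrightarrow> vec.subspace X \<and> vec.dim X = d"
  by (simp add: subspaces_of_dim_def)

lemma subspaces_of_dimI:
  "vec.subspace X \<Longrightarrow> vec.dim X = d \<Longrightarrow> X \<in> subspaces_of_dim d"
  by (simp add: subspaces_of_dim_def)

lemma subspace_basis_extend: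
  fixes T :: "('a::field ^ 'n) set"
  assumes "vec.subspace T" "P \<subseteq> T" "vec.independent P"
  obtains Q where "P \<subseteq> Q" "Q \<subseteq> T" "vec.independent Q" "vec.span Q = T" "card Q = vec.dim T"
proof -
  obtain Q where Q: "P \<subseteq> Q" "Q \<subseteq> T" "vec.independent Q" "T \<subseteq> vec.span Q"
    using vec.maximal_independent_subset_extend[OF assms(2,3)] by blast
  then have "vec.span Q = T" using vec.span_subspace assms by blast
  moreover have "card Q = vec.dim T" using vec.basis_card_eq_dim Q by blast
  ultimately show ?thesis using that Q by blast
qed

lemma subspace_basis:
  fixes S :: "('a::field ^ 'n) set"
  assumes "vec.subspace S"
  obtains P where "P \<subseteq> S" "vec.independent P" "vec.span P = S" "card P = vec.dim S"
  by (rule subspace_basis_extend[OF assms empty_subsetI vec.independent_empty])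

lemma exists_subspace_of_dim:
  fixes X :: "('a::field ^ 'n) set"
  assumes "vec.subspace X" "m \<le> vec.dim X"
  obtains T where "T \<in> subspaces_of_dim m" "T \<subseteq> X"
proof -
  obtain P where P: "P \<subseteq> X" "vec.independent P" "vec.span P = X" "card P = vec.dim X"
    by (rule subspace_basis[OF assms(1)])
  then obtain P' where P': "P' \<subseteq> P" "card P' = m"
    using obtain_subset_with_card_n[of m P] assms(2) P(4) by auto
  have "vec.independent P'" using P(2) P'(1) vec.independent_mono by blast
  then have "vec.span P' \<in> subspaces_of_dim m"
    using P'(2) vec.dim_span_eq_card_independent by (intro subspaces_of_dimI) auto
  moreover have "vec.span P' \<subseteq> X" using P(1) P'(1) assms(1) vec.span_minimal by blast
  ultimately show ?thesis using that by blast
qed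

lemma dim_Int_less:
  fixes X Y :: "('a::field ^ 'n) set"
  assumes "vec.subspace X" "vec.subspace Y" "\<not> X \<subseteq> Y"
  shows "vec.dim (X \<inter> Y) < vec.dim X"
proof (rule ccontr)
  assume "\<not> ?thesis"
  then have "X \<inter> Y = X" using vec.subspace_dim_equal[of "X \<inter> Y" X] assms vec.subspace_inter by force
  with assms(3) show False by blast
qed

lemma dim_add_le_dim_Int:
  fixes W X Y :: "('a::field ^ 'n) set"
  assumes "vec.subspace W" "vec.subspace X" "vec.subspace Y" "X \<subseteq> W" "Y \<subseteq> W"
  shows "vec.dim X + vec.dim Y \<le> vec.dim W + vec.dim (X \<inter> Y)"
proof -
  have "subspace_sum X Y \<subseteq> W" using assms by (auto intro: vec.subspace_add)
  then have "vec.dim (subspace_sum X Y) \<le> vec.dim W" by (rule vec.dim_subset)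
  then show ?thesis using vec.dim_sums_Int[OF assms(2,3)] by linarith
qed

lemma subspace_sum_upper:
  fixes X Y :: "('a::field ^ 'n) set"
  assumes "vec.subspace X" "vec.subspace Y"
  shows "X \<subseteq> subspace_sum X Y" "Y \<subseteq> subspace_sum X Y"
proof -
  show "X \<subseteq> subspace_sum X Y" using assms(2) by (force intro: exI[of _ 0] simp: vec.subspace_0)
  show "Y \<subseteq> subspace_sum X Y"
  proof
    fix y assume "y \<in> Y"
    then show "y \<in> subspace_sum X Y"
      using assms(1) by (intro CollectI exI[of _ 0] exI[of _ y]) (simp add: vec.subspace_0)
  qed
qed

lemma grassmann_adj_sym: "grassmann_adj m U W \<longleftrightarrow> grassmann_adj m W U"
  by (auto simp: grassmann_adj_def Int_commute)

lemma grassmann_adj_common_hyperplane: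
  fixes U W H :: "('a::field ^ 'n) set"
  assumes "U \<in> subspaces_of_dim (k + 1)" "W \<in> subspaces_of_dim (k + 1)" "U \<noteq> W"
    and "H \<in> subspaces_of_dim k" "H \<subseteq> U" "H \<subseteq> W"
  shows "U \<inter> W = H" "grassmann_adj (k + 1) U W"
proof -
  have U: "vec.subspace U" "vec.dim U = k + 1" and W: "vec.subspace W" "vec.dim W = k + 1"
    and H: "vec.subspace H" "vec.dim H = k"
    using assms subspaces_of_dimD by blast+
  have "\<not> U \<subseteq> W" using vec.subspace_dim_equal U W assms(3) by force
  then have "vec.dim (U \<inter> W) < k + 1" using dim_Int_less U W by fastforce
  moreover have "H \<subseteq> U \<inter> W" using assms(5,6) by blast
  ultimately show UW: "U \<inter> W = H"
    using vec.subspace_dim_equal[OF H(1) vec.subspace_inter[OF U(1) W(1)]] H(2) by force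
  show "grassmann_adj (k + 1) U W" using assms(1,2) H(2) by (simp add: grassmann_adj_def UW)
qed

section \<open>Transitivity of the linear group on flags\<close>

lemma bij_betw_extend:
  assumes "bij_betw h A A'" "A \<subseteq> B" "A' \<subseteq> B'" "finite B" "finite B'" "card B = card B'"
  obtains h' where "bij_betw h' B B'" "\<forall>x\<in>A. h' x = h x"
proof -
  have "card A = card A'" using assms(1) by (rule bij_betw_same_card)
  moreover have "finite A" "finite A'" using assms(2-5) finite_subset by auto
  ultimately have "card (B - A) = card (B' - A')"
    using assms(2,3,6) by (simp add: card_Diff_subset)
  then obtain h2 where h2: "bij_betw h2 (B - A) (B' - A')"
    using finite_same_card_bij[of "B - A" "B' - A'"] assms(4,5) by auto
  define h' where "h' x = (if x \<in> A then h x else h2 x)" for x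
  have "bij_betw h' A A'"
    using assms(1) by (simp add: h'_def cong: bij_betw_cong)
  moreover have "bij_betw h' (B - A) (B' - A')"
    using h2 by (rule bij_betw_cong[THEN iffD1, rotated]) (simp add: h'_def)
  ultimately have "bij_betw h' (A \<union> (B - A)) (A' \<union> (B' - A'))"
    by (rule bij_betw_combine) blast
  moreover have "A \<union> (B - A) = B" "A' \<union> (B' - A') = B'" using assms(2,3) by auto
  ultimately have "bij_betw h' B B'" by simp
  moreover have "\<forall>x\<in>A. h' x = h x" by (simp add: h'_def)
  ultimately show ?thesis by (rule that)
qed

lemma flag_transitive:
  fixes S T S' T' :: "('a::field ^ 'n) set"
  assumes "S \<in> subspaces_of_dim d" "T \<in> subspaces_of_dim e" "S \<subseteq> T"
    and "S' \<in> subspaces_of_dim d" "T' \<in> subspaces_of_dim e" "S' \<subseteq> T'"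
  obtains g where "Vector_Spaces.linear (*s) (*s) g" "inj g" "g ` S = S'" "g ` T = T'"
proof -
  have sub: "vec.subspace S" "vec.subspace T" "vec.subspace S'" "vec.subspace T'"
    and dims: "vec.dim S = d" "vec.dim T = e" "vec.dim S' = d" "vec.dim T' = e"
    using subspaces_of_dimD[OF assms(1)] subspaces_of_dimD[OF assms(2)]
      subspaces_of_dimD[OF assms(4)] subspaces_of_dimD[OF assms(5)] by simp_all
  obtain P where P: "P \<subseteq> S" "vec.independent P" "vec.span P = S" "card P = vec.dim S"
    by (rule subspace_basis[OF sub(1)])
  obtain Q where Q: "P \<subseteq> Q" "Q \<subseteq> T" "vec.independent Q" "vec.span Q = T" "card Q = vec.dim T"
    by (rule subspace_basis_extend[OF sub(2) order_trans[OF P(1) assms(3)] P(2)])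
  obtain P' where P': "P' \<subseteq> S'" "vec.independent P'" "vec.span P' = S'" "card P' = vec.dim S'"
    by (rule subspace_basis[OF sub(3)])
  obtain Q' where Q': "P' \<subseteq> Q'" "Q' \<subseteq> T'" "vec.independent Q'" "vec.span Q' = T'" "card Q' = vec.dim T'"
    by (rule subspace_basis_extend[OF sub(4) order_trans[OF P'(1) assms(6)] P'(2)])
  have fin: "finite P" "finite P'" "finite Q" "finite Q'"
    using P(2) P'(2) Q(3) Q'(3) by (simp_all add: vec.finiteI_independent)
  obtain h0 where h0: "bij_betw h0 P P'"
    using finite_same_card_bij[OF fin(1,2)] P(4) P'(4) dims by auto
  obtain h where h: "bij_betw h Q Q'" "\<forall>x\<in>P. h x = h0 x"
    by (rule bij_betw_extend[OF h0 Q(1) Q'(1) fin(3,4)]) (simp add: Q(5) Q'(5) dims)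
  obtain g where g: "Vector_Spaces.linear (*s) (*s) g" "inj g" "\<forall>x\<in>Q. g x = h x"
    using vec.linear_independent_extend_inj[of Q h] Q(3) Q'(3) h(1)
    unfolding bij_betw_def by metis
  have "g ` P = h0 ` P" using g(3) h(2) Q(1) by (intro image_cong) auto
  then have gP: "g ` P = P'" using h0 by (simp add: bij_betw_def)
  have "g ` Q = h ` Q" using g(3) by (intro image_cong) auto
  then have gQ: "g ` Q = Q'" using h(1) by (simp add: bij_betw_def)
  have "g ` S = S'" "g ` T = T'"
    using vec.linear_span_image[OF g(1), of P] vec.linear_span_image[OF g(1), of Q]
      gP gQ P(3) P'(3) Q(4) Q'(4) by simp_all
  with g(1,2) show ?thesis by (rule that)
qed

lemma image_subspaces_of_dim:
  fixes g :: "'a::field ^ 'n \<Rightarrow> 'a ^ 'n"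
  assumes "Vector_Spaces.linear (*s) (*s) g" "inj g" "X \<in> subspaces_of_dim d"
  shows "g ` X \<in> subspaces_of_dim d"
proof (rule subspaces_of_dimI)
  show "vec.subspace (g ` X)" using vec.linear_subspace_image assms subspaces_of_dimD by blast
  have "vec.dim (g ` X) = vec.dim X"
    by (rule vec.dim_image_eq[OF assms(1)]) (use assms(2) in \<open>auto intro: inj_on_subset\<close>)
  then show "vec.dim (g ` X) = d" using subspaces_of_dimD[OF assms(3)] by simp
qed

lemma card_flag_invariant:
  fixes F :: "('a::field ^ 'n) set \<Rightarrow> ('a ^ 'n) set \<Rightarrow> 'b set"
  assumes mono: "\<And>g V B. Vector_Spaces.linear (*s) (*s) g \<Longrightarrow> inj g \<Longrightarrow>
      card (F V B) \<le> card (F (g ` V) (g ` B))"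
    and "B \<in> subspaces_of_dim e" "V \<in> subspaces_of_dim d" "B \<subseteq> V"
    and "B' \<in> subspaces_of_dim e" "V' \<in> subspaces_of_dim d" "B' \<subseteq> V'"
  shows "card (F V B) = card (F V' B')"
proof (rule antisym)
  obtain g where g: "Vector_Spaces.linear (*s) (*s) g" "inj g" "g ` B = B'" "g ` V = V'"
    using flag_transitive[OF assms(2-7)] by blast
  show "card (F V B) \<le> card (F V' B')" using mono[OF g(1,2), of V B] g(3,4) by simp
  obtain g' where g': "Vector_Spaces.linear (*s) (*s) g'" "inj g'" "g' ` B' = B" "g' ` V' = V"
    using flag_transitive[OF assms(5-7,2-4)] by blast
  show "card (F V' B') \<le> card (F V B)" using mono[OF g'(1,2), of V' B'] g'(3,4) by simp
qed

section \<open>Counts that only depend on a flag\<close>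

definition flags :: "nat \<Rightarrow> ('a::field ^ 'n) set \<Rightarrow> (('a ^ 'n) set \<times> ('a ^ 'n) set) set" where
  "flags k U = {(T, H). T \<in> subspaces_of_dim (k - 1) \<and> H \<in> subspaces_of_dim k \<and> T \<subseteq> H \<and> H \<subseteq> U}"

definition flags_avoiding ::
    "nat \<Rightarrow> ('a::field ^ 'n) set \<Rightarrow> ('a ^ 'n) set \<Rightarrow> (('a ^ 'n) set \<times> ('a ^ 'n) set) set" where
  "flags_avoiding k U B = {(T, H) \<in> flags k U. \<not> T \<subseteq> B}"

definition others_containing :: "nat \<Rightarrow> ('a::field ^ 'n) set \<Rightarrow> ('a ^ 'n) set \<Rightarrow> ('a ^ 'n) set set" where
  "others_containing m V B = {W \<in> subspaces_of_dim m. B \<subseteq> W \<and> W \<noteq> V}"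

definition grassmann_neighbours :: "nat \<Rightarrow> ('a::field ^ 'n) set \<Rightarrow> ('a ^ 'n) set set" where
  "grassmann_neighbours m V = {W. grassmann_adj m V W}"

lemma inj_on_image_pair: "inj g \<Longrightarrow> inj_on (\<lambda>(T, H). (g ` T, g ` H)) A"
  by (auto simp: inj_on_def inj_image_eq_iff)

context
  fixes g :: "'a::{field,finite} ^ 'n \<Rightarrow> 'a ^ 'n"
  assumes linear_g: "Vector_Spaces.linear (*s) (*s) g" and inj_g: "inj g"
begin

lemma card_flags_le_image: "card (flags k U) \<le> card (flags k (g ` U))"
proof (rule card_inj_on_le[OF inj_on_image_pair[OF inj_g]])
  show "(\<lambda>(T, H). (g ` T, g ` H)) ` flags k U \<subseteq> flags k (g ` U)"
    by (auto simp: flags_def intro!: image_subspaces_of_dim[OF linear_g inj_g] image_mono)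
qed simp

lemma card_flags_avoiding_le_image:
  "card (flags_avoiding k U B) \<le> card (flags_avoiding k (g ` U) (g ` B))"
proof (rule card_inj_on_le[OF inj_on_image_pair[OF inj_g]])
  show "(\<lambda>(T, H). (g ` T, g ` H)) ` flags_avoiding k U B \<subseteq> flags_avoiding k (g ` U) (g ` B)"
    by (auto simp: flags_avoiding_def flags_def inj_image_subset_iff[OF inj_g]
        intro!: image_subspaces_of_dim[OF linear_g inj_g] image_mono)
qed simp

lemma card_others_containing_le_image:
  "card (others_containing m V B) \<le> card (others_containing m (g ` V) (g ` B))"
proof (rule card_inj_on_le[OF inj_on_image[OF inj_on_subset[OF inj_g subset_UNIV]]])
  show "(`) g ` others_containing m V B \<subseteq> others_containing m (g ` V) (g ` B)"
    by (auto simp: others_containing_def inj_image_eq_iff[OF inj_g]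
        intro!: image_subspaces_of_dim[OF linear_g inj_g] image_mono)
qed simp

lemma card_grassmann_neighbours_le_image:
  "card (grassmann_neighbours m V) \<le> card (grassmann_neighbours m (g ` V))"
proof (rule card_inj_on_le[OF inj_on_image[OF inj_on_subset[OF inj_g subset_UNIV]]])
  show "(`) g ` grassmann_neighbours m V \<subseteq> grassmann_neighbours m (g ` V)"
  proof
    fix W' assume "W' \<in> (`) g ` grassmann_neighbours m V"
    then obtain W where W: "grassmann_adj m V W" "W' = g ` W"
      by (auto simp: grassmann_neighbours_def)
    have "g ` (V \<inter> W) = g ` V \<inter> g ` W" using inj_g by (simp add: image_Int)
    moreover have "V \<inter> W \<in> subspaces_of_dim (m - 1)" using W(1)
      by (auto simp: grassmann_adj_def subspaces_of_dim_def vec.subspace_inter)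
    ultimately have "g ` V \<inter> g ` W \<in> subspaces_of_dim (m - 1)"
      using image_subspaces_of_dim[OF linear_g inj_g] by metis
    then show "W' \<in> grassmann_neighbours m (g ` V)"
      using W image_subspaces_of_dim[OF linear_g inj_g]
      by (auto simp: grassmann_neighbours_def grassmann_adj_def subspaces_of_dim_def)
  qed
qed simp

end

lemma flags_nonempty:
  assumes "U \<in> subspaces_of_dim (k + 1)"
  shows "flags k U \<noteq> {}"
proof -
  obtain H where H: "H \<in> subspaces_of_dim k" "H \<subseteq> U"
    using exists_subspace_of_dim[of U k] subspaces_of_dimD[OF assms] by auto
  obtain T where T: "T \<in> subspaces_of_dim (k - 1)" "T \<subseteq> H"
    using exists_subspace_of_dim[of H "k - 1"] subspaces_of_dimD[OF H(1)] by auto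
  from H T show ?thesis by (auto simp: flags_def)
qed

section \<open>Designs in which every (k-1)-subspace lies in exactly one block\<close>

locale q_steiner_system =
  fixes D :: "('a::{field,finite} ^ 'n) set set" and k :: nat
  assumes k_pos: "1 \<le> k" and design: "is_q_design (k - 1) k 1 D"
begin

lemma block_of_dim: "B \<in> D \<Longrightarrow> B \<in> subspaces_of_dim k"
  using design by (auto simp: is_q_design_def)

lemma unique_block: "T \<in> subspaces_of_dim (k - 1) \<Longrightarrow> \<exists>!B. B \<in> D \<and> T \<subseteq> B"
proof -
  assume "T \<in> subspaces_of_dim (k - 1)"
  then have "card {B \<in> D. T \<subseteq> B} = 1" using design by (auto simp: is_q_design_def)
  then obtain B where "{B \<in> D. T \<subseteq> B} = {B}" by (rule card_1_singletonE)
  then show ?thesis by (auto simp: set_eq_iff)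
qed

definition block :: "('a ^ 'n) set \<Rightarrow> ('a ^ 'n) set" where
  "block T = (THE B. B \<in> D \<and> T \<subseteq> B)"

lemma block_spec: "T \<in> subspaces_of_dim (k - 1) \<Longrightarrow> block T \<in> D \<and> T \<subseteq> block T"
  unfolding block_def using theI'[OF unique_block] by blast

lemma block_eqI: "T \<in> subspaces_of_dim (k - 1) \<Longrightarrow> B \<in> D \<Longrightarrow> T \<subseteq> B \<Longrightarrow> block T = B"
  unfolding block_def using the1_equality[OF unique_block] by blast

lemma block_in_subspace_unique:
  assumes "B1 \<in> D" "B2 \<in> D" "B1 \<subseteq> U" "B2 \<subseteq> U" "U \<in> subspaces_of_dim (k + 1)"
  shows "B1 = B2"
proof -
  have B1: "vec.subspace B1" "vec.dim B1 = k" and B2: "vec.subspace B2" "vec.dim B2 = k"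
    and U: "vec.subspace U" "vec.dim U = k + 1"
    using block_of_dim assms subspaces_of_dimD by blast+
  have "k - 1 \<le> vec.dim (B1 \<inter> B2)"
    using dim_add_le_dim_Int[OF U(1) B1(1) B2(1) assms(3,4)] B1(2) B2(2) U(2) by linarith
  then obtain T where "T \<in> subspaces_of_dim (k - 1)" "T \<subseteq> B1 \<inter> B2"
    using exists_subspace_of_dim vec.subspace_inter[OF B1(1) B2(1)] by blast
  then show ?thesis using unique_block assms(1,2) by blast
qed

definition free_subspaces :: "('a ^ 'n) set set" where
  "free_subspaces = {U \<in> subspaces_of_dim (k + 1). \<not> (\<exists>B \<in> D. B \<subseteq> U)}"

definition new_block_neighbours :: "('a ^ 'n) set \<Rightarrow> ('a ^ 'n) set set" where
  "new_block_neighbours U = {W. grassmann_adj (k + 1) U W \<and> (\<exists>B \<in> D. B \<subseteq> W \<and> \<not> B \<subseteq> U)}"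

definition new_block_flags :: "('a ^ 'n) set \<Rightarrow> (('a ^ 'n) set \<times> ('a ^ 'n) set) set" where
  "new_block_flags U = {(T, H) \<in> flags k U. \<not> block T \<subseteq> U}"

lemma flag_sum_in_new_block_neighbours:
  assumes U: "U \<in> subspaces_of_dim (k + 1)" and TH: "(T, H) \<in> new_block_flags U"
  shows "subspace_sum (block T) H \<in> new_block_neighbours U"
    and "U \<inter> subspace_sum (block T) H = H" and "block T \<inter> U = T"
proof -
  have T: "T \<in> subspaces_of_dim (k - 1)" and H: "H \<in> subspaces_of_dim k" "T \<subseteq> H" "H \<subseteq> U"
    and BU: "\<not> block T \<subseteq> U"
    using TH by (auto simp: new_block_flags_def flags_def)
  define B where "B = block T"
  have B: "B \<in> D" "T \<subseteq> B" using block_spec[OF T] by (simp_all add: B_def)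
  have Bs: "vec.subspace B" "vec.dim B = k" and Ts: "vec.subspace T" "vec.dim T = k - 1"
    and Hs: "vec.subspace H" "vec.dim H = k" and Us: "vec.subspace U"
    using subspaces_of_dimD block_of_dim[OF B(1)] T H(1) U by blast+
  have "vec.dim (B \<inter> U) \<le> vec.dim T"
    using dim_Int_less[OF Bs(1) Us] BU Bs(2) Ts(2) by (simp add: B_def)
  moreover have "T \<subseteq> B \<inter> U" using B(2) H(2,3) by blast
  ultimately have BT: "B \<inter> U = T"
    using vec.subspace_dim_equal[OF Ts(1) vec.subspace_inter[OF Bs(1) Us]] by simp
  then show "block T \<inter> U = T" by (simp add: B_def)
  define W where "W = subspace_sum B H"
  have "B \<inter> H = T" using BT H(2,3) B(2) by blast
  then have "vec.dim W + (k - 1) = k + k"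
    using vec.dim_sums_Int[OF Bs(1) Hs(1)] Bs(2) Hs(2) Ts(2) by (simp add: W_def)
  then have W: "W \<in> subspaces_of_dim (k + 1)"
    using k_pos vec.subspace_sums[OF Bs(1) Hs(1)] by (intro subspaces_of_dimI) (simp_all add: W_def)
  have BW: "B \<subseteq> W" and HW: "H \<subseteq> W" using subspace_sum_upper[OF Bs(1) Hs(1)] by (simp_all add: W_def)
  then have "U \<noteq> W" using BU by (auto simp: B_def)
  then have "U \<inter> W = H" "grassmann_adj (k + 1) U W"
    using grassmann_adj_common_hyperplane[OF U W _ H(1) H(3) HW] by simp_all
  moreover have "W \<in> new_block_neighbours U"
    unfolding new_block_neighbours_def using calculation(2) B(1) BW BU B_def by blast
  ultimately show "U \<inter> subspace_sum (block T) H = H" "subspace_sum (block T) H \<in> new_block_neighbours U"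
    unfolding W_def B_def by simp_all
qed

lemma new_block_neighbour_flag:
  assumes U: "U \<in> subspaces_of_dim (k + 1)" and adj: "grassmann_adj (k + 1) U W"
    and B: "B \<in> D" "B \<subseteq> W" "\<not> B \<subseteq> U"
  shows "(B \<inter> U, U \<inter> W) \<in> new_block_flags U" and "subspace_sum (block (B \<inter> U)) (U \<inter> W) = W"
proof -
  have W: "W \<in> subspaces_of_dim (k + 1)" and HW: "vec.dim (U \<inter> W) = k"
    using adj by (simp_all add: grassmann_adj_def)
  have Bs: "vec.subspace B" "vec.dim B = k" and Us: "vec.subspace U"
    and Ws: "vec.subspace W" "vec.dim W = k + 1"
    using subspaces_of_dimD block_of_dim[OF B(1)] U W by blast+
  define H where "H = U \<inter> W"
  have Hs: "vec.subspace H" "vec.dim H = k"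
    using vec.subspace_inter[OF Us Ws(1)] HW by (simp_all add: H_def)
  have BH: "B \<inter> H = B \<inter> U" using B(2) by (auto simp: H_def)
  have "vec.dim (B \<inter> U) < k" using dim_Int_less[OF Bs(1) Us B(3)] Bs(2) by simp
  moreover have "k + k \<le> k + 1 + vec.dim (B \<inter> U)"
    using dim_add_le_dim_Int[OF Ws(1) Bs(1) Hs(1) B(2)] Bs(2) Hs(2) Ws(2) BH by (simp add: H_def)
  ultimately have dimT: "vec.dim (B \<inter> U) = k - 1" by linarith
  then have T: "B \<inter> U \<in> subspaces_of_dim (k - 1)"
    using vec.subspace_inter[OF Bs(1) Us] by (intro subspaces_of_dimI)
  have block_T: "block (B \<inter> U) = B" using block_eqI[OF T B(1)] by simp
  have "H \<in> subspaces_of_dim k" using Hs by (intro subspaces_of_dimI)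
  then show "(B \<inter> U, U \<inter> W) \<in> new_block_flags U"
    using T block_T B(2,3) by (auto simp: new_block_flags_def flags_def H_def)
  have "subspace_sum B H \<subseteq> W" using Ws(1) B(2) by (auto simp: H_def intro: vec.subspace_add)
  moreover have "vec.dim (subspace_sum B H) = k + 1"
    using vec.dim_sums_Int[OF Bs(1) Hs(1)] Bs(2) Hs(2) BH dimT k_pos by simp
  ultimately have "subspace_sum B H = W"
    using vec.subspace_dim_equal[OF vec.subspace_sums[OF Bs(1) Hs(1)] Ws(1)] Ws(2) by simp
  then show "subspace_sum (block (B \<inter> U)) (U \<inter> W) = W" by (simp add: block_T H_def)
qed

lemma block_in_new_block_flag:
  assumes "(T, H) \<in> new_block_flags U"
  shows "block T \<in> D" "block T \<subseteq> subspace_sum (block T) H"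
proof -
  have T: "T \<in> subspaces_of_dim (k - 1)" and H: "H \<in> subspaces_of_dim k"
    using assms by (auto simp: new_block_flags_def flags_def)
  show B: "block T \<in> D" using block_spec[OF T] by simp
  show "block T \<subseteq> subspace_sum (block T) H"
    using subspace_sum_upper(1) subspaces_of_dimD[OF H] subspaces_of_dimD[OF block_of_dim[OF B]]
    by blast
qed

lemma card_new_block_neighbours:
  assumes U: "U \<in> subspaces_of_dim (k + 1)"
  shows "card (new_block_neighbours U) = card (new_block_flags U)"
proof -
  define sum_flag where "sum_flag = (\<lambda>(T, H). subspace_sum (block T) H)"
  have "inj_on sum_flag (new_block_flags U)"
  proof (rule inj_onI, clarify)
    fix T H T' H'
    assume p: "(T, H) \<in> new_block_flags U" and p': "(T', H') \<in> new_block_flags U"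
      and eq: "sum_flag (T, H) = sum_flag (T', H')"
    define W where "W = subspace_sum (block T) H"
    have W': "W = subspace_sum (block T') H'" using eq by (simp add: W_def sum_flag_def)
    have W: "W \<in> new_block_neighbours U" "U \<inter> W = H" "block T \<inter> U = T" "block T \<subseteq> W"
      using flag_sum_in_new_block_neighbours[OF U p] block_in_new_block_flag(2)[OF p]
      unfolding W_def by blast+
    have W'': "U \<inter> W = H'" "block T' \<inter> U = T'" "block T' \<subseteq> W"
      using flag_sum_in_new_block_neighbours(2,3)[OF U p'] block_in_new_block_flag(2)[OF p']
      unfolding W' by blast+
    have "W \<in> subspaces_of_dim (k + 1)"
      using W(1) by (simp add: new_block_neighbours_def grassmann_adj_def)
    then have "block T = block T'"
      using block_in_subspace_unique[OF block_in_new_block_flag(1)[OF p]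
          block_in_new_block_flag(1)[OF p'] W(4) W''(3)] by simp
    then show "T = T' \<and> H = H'" using W(2,3) W''(1,2) by argo
  qed
  moreover have "sum_flag ` new_block_flags U = new_block_neighbours U"
  proof
    show "sum_flag ` new_block_flags U \<subseteq> new_block_neighbours U"
      using flag_sum_in_new_block_neighbours(1)[OF U] by (auto simp: sum_flag_def)
    show "new_block_neighbours U \<subseteq> sum_flag ` new_block_flags U"
    proof
      fix W assume "W \<in> new_block_neighbours U"
      then obtain B where "grassmann_adj (k + 1) U W" "B \<in> D" "B \<subseteq> W" "\<not> B \<subseteq> U"
        by (auto simp: new_block_neighbours_def)
      then have "(B \<inter> U, U \<inter> W) \<in> new_block_flags U" "W = sum_flag (B \<inter> U, U \<inter> W)"
        using new_block_neighbour_flag[OF U] by (simp_all add: sum_flag_def)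
      then show "W \<in> sum_flag ` new_block_flags U" by (rule rev_image_eqI)
    qed
  qed
  ultimately show ?thesis using card_image by fastforce
qed

section \<open>The subspaces containing no block\<close>

lemma nonfree_neighbours_of_free:
  assumes "c \<in> free_subspaces"
  shows "{v \<in> subspaces_of_dim (k + 1) - free_subspaces. grassmann_adj (k + 1) c v}
      = new_block_neighbours c"
    and "new_block_flags c = flags k c"
proof -
  have no_block: "\<not> B \<subseteq> c" if "B \<in> D" for B using assms that by (auto simp: free_subspaces_def)
  show "{v \<in> subspaces_of_dim (k + 1) - free_subspaces. grassmann_adj (k + 1) c v}
      = new_block_neighbours c"
    using no_block by (auto simp: free_subspaces_def new_block_neighbours_def grassmann_adj_def)
  show "new_block_flags c = flags k c"
    using no_block block_spec by (auto simp: new_block_flags_def flags_def)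
qed

lemma card_nonfree_neighbours_of_free:
  assumes "c \<in> free_subspaces"
  shows "card {v \<in> subspaces_of_dim (k + 1) - free_subspaces. grassmann_adj (k + 1) c v}
      = card (flags k c)"
proof -
  have "c \<in> subspaces_of_dim (k + 1)" using assms by (simp add: free_subspaces_def)
  then show ?thesis
    using card_new_block_neighbours nonfree_neighbours_of_free[OF assms] by simp
qed

lemma nonfree_neighbours_split:
  assumes v: "v \<in> subspaces_of_dim (k + 1)" and B0: "B0 \<in> D" "B0 \<subseteq> v"
  shows "grassmann_neighbours (k + 1) v - free_subspaces
      = others_containing (k + 1) v B0 \<union> new_block_neighbours v"
proof (intro equalityI subsetI)
  fix W assume W: "W \<in> grassmann_neighbours (k + 1) v - free_subspaces"
  then have adj: "grassmann_adj (k + 1) v W" and Ws: "W \<in> subspaces_of_dim (k + 1)"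
    by (simp_all add: grassmann_neighbours_def grassmann_adj_def)
  then obtain B where B: "B \<in> D" "B \<subseteq> W" using W by (auto simp: free_subspaces_def)
  show "W \<in> others_containing (k + 1) v B0 \<union> new_block_neighbours v"
  proof (cases "B0 \<subseteq> W")
    case True
    have "W \<noteq> v"
    proof
      assume "W = v"
      then have "vec.dim v = k" using adj by (simp add: grassmann_adj_def)
      then show False using subspaces_of_dimD[OF v] by simp
    qed
    with True Ws show ?thesis unfolding others_containing_def by blast
  next
    case False
    have "\<not> B \<subseteq> v"
    proof
      assume "B \<subseteq> v"
      then have "B = B0" by (rule block_in_subspace_unique[OF B(1) B0(1) _ B0(2) v])
      with False B(2) show False by simp
    qed
    with adj B show ?thesis unfolding new_block_neighbours_def by blast
  qed
next
  fix W assume W: "W \<in> others_containing (k + 1) v B0 \<union> new_block_neighbours v"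
  have "grassmann_adj (k + 1) v W \<and> (\<exists>B \<in> D. B \<subseteq> W)"
  proof (cases "W \<in> others_containing (k + 1) v B0")
    case True
    then have "W \<in> subspaces_of_dim (k + 1)" "v \<noteq> W" "B0 \<subseteq> W"
      by (auto simp: others_containing_def)
    then show ?thesis
      using grassmann_adj_common_hyperplane(2)[OF v _ _ block_of_dim[OF B0(1)] B0(2)] B0(1) by blast
  next
    case False
    then show ?thesis using W unfolding new_block_neighbours_def by blast
  qed
  then show "W \<in> grassmann_neighbours (k + 1) v - free_subspaces"
    unfolding grassmann_neighbours_def free_subspaces_def by blast
qed

lemma others_containing_new_block_neighbours_disjoint:
  assumes v: "v \<in> subspaces_of_dim (k + 1)" and B0: "B0 \<in> D" "B0 \<subseteq> v"
  shows "others_containing (k + 1) v B0 \<inter> new_block_neighbours v = {}"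
proof (rule ccontr)
  assume "others_containing (k + 1) v B0 \<inter> new_block_neighbours v \<noteq> {}"
  then obtain W B where "W \<in> subspaces_of_dim (k + 1)" "B0 \<subseteq> W" "B \<in> D" "B \<subseteq> W" "\<not> B \<subseteq> v"
    by (auto simp: others_containing_def new_block_neighbours_def)
  then show False using block_in_subspace_unique[of B B0 W] B0 by blast
qed

lemma new_block_flags_eq_flags_avoiding:
  assumes v: "v \<in> subspaces_of_dim (k + 1)" and B0: "B0 \<in> D" "B0 \<subseteq> v"
  shows "new_block_flags v = flags_avoiding k v B0"
proof -
  have "block T \<subseteq> v \<longleftrightarrow> T \<subseteq> B0" if T: "T \<in> subspaces_of_dim (k - 1)" for T
    using block_spec[OF T] block_eqI[OF T B0(1)] block_in_subspace_unique[OF _ B0(1) _ B0(2) v] B0(2)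
    by blast
  then show ?thesis by (auto simp: new_block_flags_def flags_avoiding_def flags_def)
qed

lemma card_free_neighbours_of_nonfree:
  assumes v: "v \<in> subspaces_of_dim (k + 1)" and B0: "B0 \<in> D" "B0 \<subseteq> v"
  shows "card {c \<in> free_subspaces. grassmann_adj (k + 1) v c}
      = card (grassmann_neighbours (k + 1) v)
        - (card (others_containing (k + 1) v B0) + card (flags_avoiding k v B0))"
proof -
  let ?N = "grassmann_neighbours (k + 1) v"
  have "{c \<in> free_subspaces. grassmann_adj (k + 1) v c} = ?N - (?N - free_subspaces)"
    by (auto simp: grassmann_neighbours_def)
  then have "card {c \<in> free_subspaces. grassmann_adj (k + 1) v c}
      = card ?N - card (?N - free_subspaces)"
    by (simp add: card_Diff_subset)
  also have "card (?N - free_subspaces)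
      = card (others_containing (k + 1) v B0) + card (new_block_neighbours v)"
    using nonfree_neighbours_split[OF assms] others_containing_new_block_neighbours_disjoint[OF assms]
    by (simp add: card_Un_disjoint)
  finally show ?thesis
    using card_new_block_neighbours[OF v] new_block_flags_eq_flags_avoiding[OF assms] by simp
qed

lemma card_nonfree_neighbours_of_free_eq:
  assumes "c \<in> free_subspaces" "c' \<in> free_subspaces"
  shows "card {v \<in> subspaces_of_dim (k + 1) - free_subspaces. grassmann_adj (k + 1) c v}
      = card {v \<in> subspaces_of_dim (k + 1) - free_subspaces. grassmann_adj (k + 1) c' v}"
proof -
  have c: "c \<in> subspaces_of_dim (k + 1)" and c': "c' \<in> subspaces_of_dim (k + 1)"
    using assms by (simp_all add: free_subspaces_def)
  have "card (flags k c) = card (flags k c')"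
    using card_flag_invariant[where F = "\<lambda>V B. flags k V", OF card_flags_le_image c c order_refl c' c' order_refl] .
  then show ?thesis using card_nonfree_neighbours_of_free assms by simp
qed

lemma card_free_neighbours_of_nonfree_eq:
  assumes v: "v \<in> subspaces_of_dim (k + 1) - free_subspaces"
    and v': "v' \<in> subspaces_of_dim (k + 1) - free_subspaces"
  shows "card {c \<in> free_subspaces. grassmann_adj (k + 1) v c}
      = card {c \<in> free_subspaces. grassmann_adj (k + 1) v' c}"
proof -
  obtain B where B: "B \<in> D" "B \<subseteq> v" using v by (auto simp: free_subspaces_def)
  obtain B' where B': "B' \<in> D" "B' \<subseteq> v'" using v' by (auto simp: free_subspaces_def)
  have flag: "B \<in> subspaces_of_dim k" "v \<in> subspaces_of_dim (k + 1)" "B \<subseteq> v"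
    and flag': "B' \<in> subspaces_of_dim k" "v' \<in> subspaces_of_dim (k + 1)" "B' \<subseteq> v'"
    using B B' v v' block_of_dim by simp_all
  have "card (grassmann_neighbours (k + 1) v) = card (grassmann_neighbours (k + 1) v')"
    using card_flag_invariant[where F = "\<lambda>V B. grassmann_neighbours (k + 1) V",
        OF card_grassmann_neighbours_le_image flag flag'] .
  moreover have "card (others_containing (k + 1) v B) = card (others_containing (k + 1) v' B')"
    using card_flag_invariant[where F = "others_containing (k + 1)",
        OF card_others_containing_le_image flag flag'] .
  moreover have "card (flags_avoiding k v B) = card (flags_avoiding k v' B')"
    using card_flag_invariant[where F = "flags_avoiding k", OF card_flags_avoiding_le_image flag flag'] .
  ultimately show ?thesis
    using card_free_neighbours_of_nonfree[OF flag(2) B] card_free_neighbours_of_nonfree[OF flag'(2) B']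
    by simp
qed

lemma free_neighbour_exists:
  assumes c0: "c0 \<in> free_subspaces" and v: "v \<in> subspaces_of_dim (k + 1) - free_subspaces"
  shows "\<exists>c \<in> free_subspaces. grassmann_adj (k + 1) v c"
proof -
  have "c0 \<in> subspaces_of_dim (k + 1)" using c0 by (simp add: free_subspaces_def)
  then have "card {v \<in> subspaces_of_dim (k + 1) - free_subspaces. grassmann_adj (k + 1) c0 v} \<noteq> 0"
    using card_nonfree_neighbours_of_free[OF c0] flags_nonempty by simp
  then obtain v1 where v1: "v1 \<in> subspaces_of_dim (k + 1) - free_subspaces" "grassmann_adj (k + 1) c0 v1"
    by (metis (no_types, lifting) card.empty empty_Collect_eq)
  then have "c0 \<in> {c \<in> free_subspaces. grassmann_adj (k + 1) v1 c}"
    using c0 grassmann_adj_sym by blast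
  then have "card {c \<in> free_subspaces. grassmann_adj (k + 1) v1 c} \<noteq> 0" by auto
  then have "card {c \<in> free_subspaces. grassmann_adj (k + 1) v c} \<noteq> 0"
    using card_free_neighbours_of_nonfree_eq[OF v v1(1)] by simp
  then show ?thesis by (metis (no_types, lifting) card.empty empty_Collect_eq)
qed

end

theorem theorem4p2:
  fixes D :: "('a::{field,finite} ^ 'n) set set"
    and k :: nat
  assumes "2 \<le> k" and "k < CARD('n)"
    and "is_q_design (k - 1) k 1 D"
  defines "C \<equiv> {U \<in> subspaces_of_dim (k + 1). \<not> (\<exists>B \<in> D. B \<subseteq> U)}"
  assumes "C \<noteq> {}" and "subspaces_of_dim (k + 1) - C \<noteq> {}"
  shows "crc_radius1 (subspaces_of_dim (k + 1)) (grassmann_adj (k + 1)) C"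
proof -
  interpret q_steiner_system D k using assms(1,3) by unfold_locales simp_all
  have C: "C = free_subspaces" by (simp add: C_def free_subspaces_def)
  obtain c0 where c0: "c0 \<in> C" using assms(5) by blast
  obtain v0 where v0: "v0 \<in> subspaces_of_dim (k + 1) - C" using assms(6) by blast
  let ?V = "subspaces_of_dim (k + 1) :: ('a ^ 'n) set set"
  let ?beta = "card {v \<in> ?V - C. grassmann_adj (k + 1) c0 v}"
  let ?gamma = "card {c \<in> C. grassmann_adj (k + 1) v0 c}"
  have "\<forall>c \<in> C. card {v \<in> ?V - C. grassmann_adj (k + 1) c v} = ?beta"
    using card_nonfree_neighbours_of_free_eq c0 unfolding C by blast
  moreover have "\<forall>v \<in> ?V - C. card {c \<in> C. grassmann_adj (k + 1) v c} = ?gamma"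
    using card_free_neighbours_of_nonfree_eq v0 unfolding C by blast
  moreover have "\<forall>v \<in> ?V. v \<in> C \<or> (\<exists>c \<in> C. grassmann_adj (k + 1) v c)"
    using free_neighbour_exists c0 unfolding C by blast
  moreover have "C \<subseteq> ?V" unfolding C_def by blast
  ultimately show ?thesis unfolding crc_radius1_def using assms(5,6) by blast
qed

end
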